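(* Let $\ell$ be any admissible transversal of a triangle $ABC$, meeting the sidelines $BC,CA,AB$ at $D,E,F$ respectively. Let $G,H,I$ be the circumcenters of triangles $AEF$, $BFD$, $CDE$ respectively. Then the lines $AG,BH,CI$ concur at a point on the circumcircle of $\triangle ABC$.
   Context: An admissible transversal of $\triangle ABC$ is a line that passes through no vertex of the triangle and is parallel to no side. *)

theory Defs
  imports "HOL-Analysis.Analysis"
begin

definition is_line :: "(real^2) set \<Rightarrow> bool" where
  "is_line l \<longleftrightarrow> affine l \<and> aff_dim l = 1"

definition admissible_transversal ::
    "real^2 \<Rightarrow> real^2 \<Rightarrow> real^2 \<Rightarrow> (real^2) set \<Rightarrow> bool" where
  "admissible_transversal A B C l \<longleftrightarrow>
     is_line l \<and> A \<notin> l \<and> B \<notin> l \<and> C \<notin> l \<and>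
     \<not> affine_parallel l (affine hull {B, C}) \<and>
     \<not> affine_parallel l (affine hull {C, A}) \<and>
     \<not> affine_parallel l (affine hull {A, B})"

(* Meaningful only for non-collinear X, Y, Z; see circumcenter_ex1. *)
definition circumcenter :: "real^2 \<Rightarrow> real^2 \<Rightarrow> real^2 \<Rightarrow> real^2" where
  "circumcenter X Y Z = (THE P. dist P X = dist P Y \<and> dist P X = dist P Z)"

definition circumcircle :: "real^2 \<Rightarrow> real^2 \<Rightarrow> real^2 \<Rightarrow> (real^2) set" where
  "circumcircle X Y Z = sphere (circumcenter X Y Z) (dist (circumcenter X Y Z) X)"

lemma dist_eq_iff_2D:
  fixes P X Y :: "real^2"
  shows "dist P X = dist P Y \<longleftrightarrow>
    2 * ((Y$1 - X$1) * P$1 + (Y$2 - X$2) * P$2) = (Y$1)\<^sup>2 + (Y$2)\<^sup>2 - (X$1)\<^sup>2 - (X$2)\<^sup>2"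
proof -
  have "dist P X = dist P Y \<longleftrightarrow> (P$1 - X$1)\<^sup>2 + (P$2 - X$2)\<^sup>2 = (P$1 - Y$1)\<^sup>2 + (P$2 - Y$2)\<^sup>2"
    by (simp add: dist_vec_def L2_set_def sum_2 dist_real_def)
  also have "\<dots> \<longleftrightarrow> 2 * ((Y$1 - X$1) * P$1 + (Y$2 - X$2) * P$2)
      = (Y$1)\<^sup>2 + (Y$2)\<^sup>2 - (X$1)\<^sup>2 - (X$2)\<^sup>2"
    by (simp add: power2_eq_square algebra_simps)
  finally show ?thesis .
qed

lemma cramer_2x2:
  fixes a b c d e f :: real
  assumes "a * d - b * c \<noteq> 0"
  shows "(a * x + b * y = e \<and> c * x + d * y = f) \<longleftrightarrow>
    x = (e * d - b * f) / (a * d - b * c) \<and> y = (a * f - e * c) / (a * d - b * c)"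
proof
  assume *: "a * x + b * y = e \<and> c * x + d * y = f"
  have "x * (a * d - b * c) = e * d - b * f" "y * (a * d - b * c) = a * f - e * c"
    using * by (auto simp: algebra_simps)
  then show "x = (e * d - b * f) / (a * d - b * c) \<and> y = (a * f - e * c) / (a * d - b * c)"
    using assms by (simp add: nonzero_eq_divide_eq)
next
  assume *: "x = (e * d - b * f) / (a * d - b * c) \<and> y = (a * f - e * c) / (a * d - b * c)"
  then have "x * (a * d - b * c) = e * d - b * f" "y * (a * d - b * c) = a * f - e * c"
    using assms by auto
  then have "(a * x + b * y) * (a * d - b * c) = e * (a * d - b * c)"
    "(c * x + d * y) * (a * d - b * c) = f * (a * d - b * c)"
    by algebra+
  then show "a * x + b * y = e \<and> c * x + d * y = f"
    using assms by simp
qed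

lemma not_collinear_det_nz:
  fixes X Y Z :: "real^2"
  assumes "\<not> collinear {X, Y, Z}"
  shows "(Y$1 - X$1) * (Z$2 - X$2) - (Y$2 - X$2) * (Z$1 - X$1) \<noteq> 0"
proof
  assume d: "(Y$1 - X$1) * (Z$2 - X$2) - (Y$2 - X$2) * (Z$1 - X$1) = 0"
  have "X \<noteq> Z"
    using assms by (auto simp: insert_commute)
  then have "Z$1 - X$1 \<noteq> 0 \<or> Z$2 - X$2 \<noteq> 0"
    by (auto simp: vec_eq_iff forall_2)
  then obtain u where "Y$1 - X$1 = u * (Z$1 - X$1)" "Y$2 - X$2 = u * (Z$2 - X$2)"
  proof
    assume nz: "Z$1 - X$1 \<noteq> 0"
    show thesis
      by (rule that[of "(Y$1 - X$1) / (Z$1 - X$1)"]) (use nz d in \<open>simp_all add: field_simps\<close>)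
  next
    assume nz: "Z$2 - X$2 \<noteq> 0"
    show thesis
      by (rule that[of "(Y$2 - X$2) / (Z$2 - X$2)"]) (use nz d in \<open>simp_all add: field_simps\<close>)
  qed
  then have "Y = u *\<^sub>R Z + (1 - u) *\<^sub>R X"
    by (simp add: vec_eq_iff forall_2 algebra_simps)
  then have "collinear {Z, Y, X}"
    unfolding collinear_3_expand by blast
  then show False
    using assms by (simp add: insert_commute)
qed

lemma circumcenter_ex1:
  fixes X Y Z :: "real^2"
  assumes "\<not> collinear {X, Y, Z}"
  shows "\<exists>!P. dist P X = dist P Y \<and> dist P X = dist P Z"
proof -
  let ?D = "2 * (Y$1 - X$1) * (2 * (Z$2 - X$2)) - 2 * (Y$2 - X$2) * (2 * (Z$1 - X$1))"
  let ?e = "(Y$1)\<^sup>2 + (Y$2)\<^sup>2 - (X$1)\<^sup>2 - (X$2)\<^sup>2"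
  let ?f = "(Z$1)\<^sup>2 + (Z$2)\<^sup>2 - (X$1)\<^sup>2 - (X$2)\<^sup>2"
  have D: "?D \<noteq> 0"
    using not_collinear_det_nz[OF assms] by (simp add: algebra_simps)
  define x where "x = (?e * (2 * (Z$2 - X$2)) - 2 * (Y$2 - X$2) * ?f) / ?D"
  define y where "y = (2 * (Y$1 - X$1) * ?f - ?e * (2 * (Z$1 - X$1))) / ?D"
  have "dist P X = dist P Y \<and> dist P X = dist P Z \<longleftrightarrow> P$1 = x \<and> P$2 = y" for P
    unfolding dist_eq_iff_2D x_def y_def cramer_2x2[OF D, symmetric]
    by (simp add: algebra_simps)
  then have "dist P X = dist P Y \<and> dist P X = dist P Z \<longleftrightarrow> P = vector [x, y]" for P
    by (simp add: vec_eq_iff forall_2)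
  then show ?thesis by simp
qed

end

theory Submission
  imports Defs
begin

text \<open>
  Let \<open>d\<close> be a direction vector of \<open>l\<close>. In a triangle the line from a vertex to the circumcenter
  and the altitude from that vertex are isogonal, so \<open>AG\<close> is the reflection, in the bisector of
  angle \<open>A\<close>, of the normal to \<open>l\<close> through \<open>A\<close>; likewise for \<open>BH\<close> and \<open>CI\<close>. Hence the three lines
  meet in the isogonal conjugate of the point at infinity in the direction normal to \<open>l\<close>, and the
  isogonal conjugate of a point at infinity lies on the circumcircle.

  The plane is identified with the complex numbers. Isogonality becomes the statement that
  \<open>G - A\<close> is a real multiple of \<open>\<i> (B - A) (C - A) cnj d\<close> (\<open>circumcenter_direction\<close>). If
  \<open>a, b, c\<close> are the vertices relative to the circumcenter \<open>Z\<close> of \<open>ABC\<close>, and \<open>\<rho>\<close> is the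
  circumradius, the common point is \<open>Z + a b c cnj d / (\<rho>\<^sup>2 d)\<close>. Its distance from \<open>Z\<close> is \<open>\<rho>\<close>, and
  the expression is symmetric in the vertices and unchanged when \<open>d\<close> is scaled by a nonzero real number, so
  a single computation at one vertex (\<open>chord_direction\<close>, \<open>isogonal_point_on_circumcenter_line\<close>)
  serves for all three. A second common point would force \<open>A, B, C\<close> onto one line.
\<close>

section \<open>The plane as the complex numbers\<close>

text \<open>The standard identification of the Euclidean plane with the complex numbers.\<close>

definition to_complex :: "real^2 \<Rightarrow> complex" where
  "to_complex X = Complex (X$1) (X$2)"

lemma to_complex_simps [simp]:
  "Re (to_complex X) = X$1" "Im (to_complex X) = X$2"
  by (simp_all add: to_complex_def)

lemma to_complex_eq_iff: "to_complex X = to_complex Y \<longleftrightarrow> X = Y"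
  by (simp add: complex_eq_iff vec_eq_iff forall_2)

lemma surj_to_complex: obtains X where "to_complex X = w"
  by (rule that[of "vector [Re w, Im w]"]) (simp add: complex_eq_iff)

lemma cmod_to_complex_diff: "cmod (to_complex X - to_complex Y) = dist X Y"
  by (simp add: cmod_def dist_vec_def L2_set_def sum_2 dist_real_def)

lemma mem_affine_hull_2_iff:
  fixes X Y P :: "real^2"
  shows "P \<in> affine hull {X, Y} \<longleftrightarrow>
    (\<exists>t. to_complex P - to_complex X = of_real t * (to_complex Y - to_complex X))"
proof -
  have "P \<in> affine hull {X, Y} \<longleftrightarrow> (\<exists>t. P = (1 - t) *\<^sub>R X + t *\<^sub>R Y)"
    unfolding affine_hull_2 mem_Collect_eq by (metis add_diff_cancel_right' diff_add_cancel)
  also have "\<dots> \<longleftrightarrow> (\<exists>t. to_complex P - to_complex X = of_real t * (to_complex Y - to_complex X))"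
    by (rule ex_cong1) (auto simp: complex_eq_iff vec_eq_iff forall_2 algebra_simps)
  finally show ?thesis .
qed

section \<open>Circumcenters and isogonal lines\<close>

lemma circumcenter_equidistant:
  assumes "\<not> collinear {X, Y, Z}"
  shows "dist (circumcenter X Y Z) X = dist (circumcenter X Y Z) Y"
    and "dist (circumcenter X Y Z) X = dist (circumcenter X Y Z) Z"
  using theI'[OF circumcenter_ex1[OF assms]] by (simp_all add: circumcenter_def)

text \<open>
  When \<open>0\<close>, \<open>s v\<close>, \<open>r u\<close> are the vertices of a triangle, the hypotheses say that \<open>g\<close> projects to the
  midpoints of the two sides through \<open>0\<close>, that is, \<open>g\<close> is the circumcenter. The conclusion says
  that \<open>g\<close> is isogonal, with respect to the angle spanned by \<open>u\<close> and \<open>v\<close>, to the normal of the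
  third side.
\<close>

lemma circumcenter_direction:
  fixes u v g :: complex and r s :: real
  assumes "2 * Re (cnj v * g) = s * (cmod v)\<^sup>2"
    and "2 * Re (cnj u * g) = r * (cmod u)\<^sup>2"
  shows "of_real (2 * Im (cnj u * v)) * g = \<i> * u * v * cnj (of_real s * v - of_real r * u)"
proof -
  obtain u1 u2 where u: "u = Complex u1 u2" by (cases u)
  obtain v1 v2 where v: "v = Complex v1 v2" by (cases v)
  obtain g1 g2 where g: "g = Complex g1 g2" by (cases g)
  have 1: "2 * (v1 * g1 + v2 * g2) = s * (v1\<^sup>2 + v2\<^sup>2)"
    and 2: "2 * (u1 * g1 + u2 * g2) = r * (u1\<^sup>2 + u2\<^sup>2)"
    using assms by (simp_all add: u v g cmod_power2)
  have "2 * (u1 * v2 - u2 * v1) * g1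
      = - ((u1 * v1 - u2 * v2) * - (s * v2 - r * u2) + (u1 * v2 + u2 * v1) * (s * v1 - r * u1))"
    using 1 2 by algebra
  moreover have "2 * (u1 * v2 - u2 * v1) * g2
      = (u1 * v1 - u2 * v2) * (s * v1 - r * u1) - (u1 * v2 + u2 * v1) * - (s * v2 - r * u2)"
    using 1 2 by algebra
  ultimately show ?thesis
    by (simp add: u v g complex_eq_iff algebra_simps)
qed

text \<open>
  The chord of the circle of radius \<open>\<rho>\<close> about \<open>0\<close> that joins \<open>a\<close> to \<open>a b c cnj d / (\<rho>\<^sup>2 d)\<close> is
  isogonal to the normal of \<open>d\<close> with respect to the angle at \<open>a\<close> of the triangle \<open>a, b, c\<close>. The
  two ends of the chord may coincide; then \<open>t = 0\<close>.
\<close>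

lemma chord_direction:
  fixes a b c d :: complex and \<rho> :: real
  assumes "cmod a = \<rho>" "cmod b = \<rho>" "cmod c = \<rho>" and "\<rho> \<noteq> 0"
    and "b \<noteq> a" "c \<noteq> a" "d \<noteq> 0"
  shows "\<exists>t. a * b * c * cnj d / ((of_real \<rho>)\<^sup>2 * d) - a
    = of_real t * (\<i> * (b - a) * (c - a) * cnj d)"
proof -
  define q :: complex where "q = (of_real \<rho>)\<^sup>2"
  define T where "T = (a * b * c * cnj d / (q * d) - a) / (\<i> * (b - a) * (c - a) * cnj d)"
  have nz: "a \<noteq> 0" "b \<noteq> 0" "c \<noteq> 0" "q \<noteq> 0" "cnj d \<noteq> 0" "b - a \<noteq> 0" "c - a \<noteq> 0"
    using assms by (auto simp: q_def)
  have inv: "cnj x = q / x" if "cmod x = \<rho>" "x \<noteq> 0" for x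
    using that complex_norm_square[of x] by (simp add: q_def field_simps)
  have cq: "cnj q = q" by (simp add: q_def)
  have T: "T = - \<i> * a * (b * c * cnj d - q * d) / (q * d * cnj d * (b - a) * (c - a))"
  proof -
    have "a * b * c * cnj d / (q * d) - a = a * (b * c * cnj d - q * d) / (q * d)"
      using nz \<open>d \<noteq> 0\<close> by (simp add: field_simps)
    then have "T = a * (b * c * cnj d - q * d) / (q * d) / (\<i> * (b - a) * (c - a) * cnj d)"
      by (simp add: T_def)
    then show ?thesis
      by (simp add: divide_inverse mult_ac)
  qed
  define m where "m = q\<^sup>2 / (a\<^sup>2 * b * c)"
  have "m \<noteq> 0"
    using nz by (simp add: m_def)
  have num: "\<i> * (q / a) * (q / b * (q / c) * d - q * cnj d)
      = - \<i> * a * (b * c * cnj d - q * d) * m"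
    using nz by (simp add: m_def field_simps power2_eq_square)
  have sides: "(q / b - q / a) * (q / c - q / a) = (b - a) * (c - a) * m"
    using nz by (simp add: m_def field_simps power2_eq_square)
  then have den: "q * cnj d * d * (q / b - q / a) * (q / c - q / a)
      = q * d * cnj d * (b - a) * (c - a) * m"
    by (simp add: mult.assoc mult.left_commute)
  \<comment> \<open>On the circle conjugation is \<open>x \<mapsto> q / x\<close>; it multiplies the numerator and
      the denominator of \<open>T\<close> by the same factor \<open>m\<close>.\<close>
  have "cnj T = \<i> * (q / a) * (q / b * (q / c) * d - q * cnj d)
      / (q * cnj d * d * (q / b - q / a) * (q / c - q / a))"
    unfolding T by (simp add: inv nz assms cq)
  also have "\<dots> = T"
    unfolding T num den using \<open>m \<noteq> 0\<close> by simp
  finally have "T \<in> \<real>"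
    by (simp add: Reals_cnj_iff)
  then obtain t where t: "T = of_real t"
    by (auto elim: Reals_cases)
  have "\<i> * (b - a) * (c - a) * cnj d \<noteq> 0"
    using nz by simp
  then have "a * b * c * cnj d / (q * d) - a = of_real t * (\<i> * (b - a) * (c - a) * cnj d)"
    using t unfolding T_def by (rule nonzero_divide_eq_eq[THEN iffD1])
  then show ?thesis
    unfolding q_def by blast
qed

text \<open>
  A point \<open>G\<close> equidistant from \<open>A\<close> and \<open>E = A + s (C - A)\<close> projects to the midpoint of \<open>AE\<close>. The
  conclusion has the form of the hypotheses of \<open>circumcenter_direction\<close>.
\<close>

lemma midpoint_projection:
  fixes A C E G :: "real^2"
  assumes "dist G A = dist G E"
    and "to_complex E - to_complex A = of_real s * (to_complex C - to_complex A)" "s \<noteq> 0"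
  shows "2 * Re (cnj (to_complex C - to_complex A) * (to_complex G - to_complex A))
    = s * (cmod (to_complex C - to_complex A))\<^sup>2"
proof -
  have E: "E$1 = A$1 + s * (C$1 - A$1)" "E$2 = A$2 + s * (C$2 - A$2)"
    using assms(2) by (auto simp: complex_eq_iff algebra_simps)
  have "s * (2 * ((C$1 - A$1) * (G$1 - A$1) + (C$2 - A$2) * (G$2 - A$2)))
      = s * (s * ((C$1 - A$1)\<^sup>2 + (C$2 - A$2)\<^sup>2))"
    using assms(1) unfolding dist_eq_iff_2D E by algebra
  then have "2 * ((C$1 - A$1) * (G$1 - A$1) + (C$2 - A$2) * (G$2 - A$2))
      = s * ((C$1 - A$1)\<^sup>2 + (C$2 - A$2)\<^sup>2)"
    unfolding mult_cancel_left using assms(3) by blast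
  then show ?thesis
    by (simp add: cmod_power2 algebra_simps)
qed

lemma not_collinear_side_points:
  fixes A B C E F :: "real^2"
  assumes ABC: "\<not> collinear {A, B, C}"
    and E: "E \<in> affine hull {C, A}" "E \<noteq> A"
    and F: "F \<in> affine hull {A, B}" "F \<noteq> A"
  shows "\<not> collinear {A, E, F}"
proof
  assume "collinear {A, E, F}"
  moreover have "collinear {C, A, E}"
    using E(1) by (metis collinear_2 collinear_3_affine_hull insert_absorb2)
  ultimately have CAF: "collinear {C, A, F}"
    using E(2) collinear_3_trans[of C A E F] by auto
  have "B \<noteq> A"
    using ABC by (auto simp: insert_commute)
  then have "collinear {A, F, B}"
    using F(1) collinear_3_affine_hull[of A B F] by (simp add: insert_commute)
  then have "collinear {C, A, B}"
    using CAF F(2) collinear_3_trans[of C A F B] by auto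
  then show False
    using ABC by (simp add: insert_commute)
qed

text \<open>
  The computation at one vertex: \<open>Z\<close> is the circumcenter of \<open>ABC\<close>, and \<open>d\<close> is any direction vector
  of the line \<open>EF\<close>. The factor \<open>k\<close> allows the same \<open>d\<close>, and hence the same \<open>P\<close>, to be used at the
  other two vertices.
\<close>

lemma isogonal_point_on_circumcenter_line:
  fixes A B C E F G P Z :: "real^2" and d :: complex and k :: real
  assumes ABC: "\<not> collinear {A, B, C}"
    and Z: "dist Z A = \<rho>" "dist Z B = \<rho>" "dist Z C = \<rho>"
    and E: "E \<in> affine hull {C, A}" "E \<noteq> A"
    and F: "F \<in> affine hull {A, B}" "F \<noteq> A"
    and G: "G = circumcenter A E F"
    and d: "to_complex E - to_complex F = of_real k * d" "d \<noteq> 0"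
    and P: "to_complex P - to_complex Z
      = (to_complex A - to_complex Z) * (to_complex B - to_complex Z) * (to_complex C - to_complex Z)
        * cnj d / ((of_real \<rho>)\<^sup>2 * d)"
  shows "P \<in> affine hull {A, G}"
proof -
  let ?z = to_complex
  have ne: "B \<noteq> A" "C \<noteq> A"
    using ABC by (auto simp: insert_commute)
  then have \<rho>: "\<rho> \<noteq> 0"
    using Z by auto
  obtain s where s: "?z E - ?z A = of_real s * (?z C - ?z A)"
    using E(1) mem_affine_hull_2_iff[of E A C] by (auto simp: insert_commute)
  obtain r where r: "?z F - ?z A = of_real r * (?z B - ?z A)"
    using F(1) mem_affine_hull_2_iff by blast
  have "s \<noteq> 0" "r \<noteq> 0"
    using s r E(2) F(2) by (auto simp: to_complex_eq_iff)
  have AEF: "\<not> collinear {A, E, F}"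
    by (rule not_collinear_side_points[OF ABC E F])
  define u v where "u = ?z B - ?z A" and "v = ?z C - ?z A"
  have "E \<noteq> F"
    using AEF by auto
  then have "k \<noteq> 0"
    using d(1) by (auto simp: to_complex_eq_iff)
  have side: "of_real s * v - of_real r * u = of_real k * d"
    unfolding u_def v_def s[symmetric] r[symmetric] using d(1) by simp
  have GE: "dist G A = dist G E" and GF: "dist G A = dist G F"
    using circumcenter_equidistant[OF AEF] by (simp_all add: G)
  note midpoint_projection[OF GE s \<open>s \<noteq> 0\<close>] midpoint_projection[OF GF r \<open>r \<noteq> 0\<close>]
  then have "of_real (2 * Im (cnj u * v)) * (?z G - ?z A)
      = \<i> * u * v * cnj (of_real s * v - of_real r * u)"
    unfolding u_def v_def by (rule circumcenter_direction)
  then have "of_real (2 * Im (cnj u * v)) * (?z G - ?z A) = of_real k * (\<i> * u * v * cnj d)"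
    by (simp add: side)
  then have w: "\<i> * u * v * cnj d = of_real (2 * Im (cnj u * v) / k) * (?z G - ?z A)"
    using \<open>k \<noteq> 0\<close> by (simp add: field_simps)
  have diff: "(x - ?z Z) - (y - ?z Z) = x - y" for x y
    by simp
  have "\<exists>t. (?z A - ?z Z) * (?z B - ?z Z) * (?z C - ?z Z) * cnj d / ((of_real \<rho>)\<^sup>2 * d)
        - (?z A - ?z Z)
      = of_real t * (\<i> * ((?z B - ?z Z) - (?z A - ?z Z)) * ((?z C - ?z Z) - (?z A - ?z Z)) * cnj d)"
    using Z \<rho> ne d(2)
    by (intro chord_direction) (simp_all add: cmod_to_complex_diff dist_commute to_complex_eq_iff)
  then obtain t where "?z P - ?z A = of_real t * (\<i> * u * v * cnj d)"
    unfolding P[symmetric] diff u_def v_def by blast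
  then have "?z P - ?z A = of_real (t * (2 * Im (cnj u * v) / k)) * (?z G - ?z A)"
    unfolding w by simp
  then show ?thesis
    unfolding mem_affine_hull_2_iff by blast
qed

section \<open>Concurrence on the circumcircle\<close>

lemma unique_common_point_of_cevians:
  fixes A B C G H I P :: "real^2"
  assumes ABC: "\<not> collinear {A, B, C}"
    and P: "P \<in> affine hull {A, G}" "P \<in> affine hull {B, H}" "P \<in> affine hull {C, I}"
  shows "affine hull {A, G} \<inter> affine hull {B, H} \<inter> affine hull {C, I} = {P}"
proof -
  have "Q = P" if Q: "Q \<in> affine hull {A, G}" "Q \<in> affine hull {B, H}" "Q \<in> affine hull {C, I}" for Q
  proof (rule ccontr)
    assume "Q \<noteq> P"
    have col: "collinear {P, Q, X}" if "P \<in> affine hull {X, Y}" "Q \<in> affine hull {X, Y}" for X Y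
    proof (rule collinear_subset)
      show "collinear (affine hull {X, Y})"
        by (simp add: collinear_affine_hull_collinear)
      show "{P, Q, X} \<subseteq> affine hull {X, Y}"
        using that by (simp add: hull_inc)
    qed
    have "collinear {P, Q, A, B, C}"
      using col P Q \<open>Q \<noteq> P\<close> collinear_triples[of P Q "{A, B, C}"] by blast
    then show False
      using ABC collinear_subset[of "{P, Q, A, B, C}" "{A, B, C}"] by blast
  qed
  then show ?thesis
    using P by blast
qed

theorem theorem4p3:
  fixes A B C D E F G H I :: "real^2" and l :: "(real^2) set"
  assumes "\<not> collinear {A, B, C}"
    and "admissible_transversal A B C l"
    and "l \<inter> affine hull {B, C} = {D}"
    and "l \<inter> affine hull {C, A} = {E}"
    and "l \<inter> affine hull {A, B} = {F}"
    and "G = circumcenter A E F"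
    and "H = circumcenter B F D"
    and "I = circumcenter C D E"
  shows "\<exists>P \<in> circumcircle A B C.
    affine hull {A, G} \<inter> affine hull {B, H} \<inter> affine hull {C, I} = {P}"
proof -
  let ?z = to_complex
  note ABC = assms(1)
  have BCA: "\<not> collinear {B, C, A}" and CAB: "\<not> collinear {C, A, B}"
    using ABC by (simp_all add: insert_commute)
  have D: "D \<in> l" "D \<in> affine hull {B, C}" and E: "E \<in> l" "E \<in> affine hull {C, A}"
    and F: "F \<in> l" "F \<in> affine hull {A, B}"
    using assms(3-5) by auto
  have l: "aff_dim l = 1" "A \<notin> l" "B \<notin> l" "C \<notin> l"
    using assms(2) by (auto simp: admissible_transversal_def is_line_def)
  then have ne: "D \<noteq> B" "D \<noteq> C" "E \<noteq> C" "E \<noteq> A" "F \<noteq> A" "F \<noteq> B"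
    using D E F by auto
  have "E \<noteq> F"
    using not_collinear_side_points[OF ABC E(2) ne(4) F(2) ne(5)] by auto
  define d where "d = ?z E - ?z F"
  have "d \<noteq> 0"
    using \<open>E \<noteq> F\<close> by (simp add: d_def to_complex_eq_iff)
  have "collinear {F, E, D}"
    by (rule collinear_subset[of l]) (use l(1) D E F in \<open>auto simp: collinear_aff_dim\<close>)
  \<comment> \<open>All three segments cut off on \<open>l\<close> are thus real multiples of \<open>d\<close>.\<close>
  then have "D \<in> affine hull {F, E}"
    using \<open>E \<noteq> F\<close> by (simp add: collinear_3_affine_hull)
  then obtain k where k: "?z D - ?z F = of_real k * d"
    unfolding mem_affine_hull_2_iff d_def by blast
  have EF: "?z E - ?z F = of_real 1 * d"
    by (simp add: d_def)
  have FD: "?z F - ?z D = of_real (- k) * d"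
    using k by (simp add: algebra_simps)
  have DE: "?z D - ?z E = of_real (k - 1) * d"
    using k by (simp add: d_def algebra_simps)
  define Z where "Z = circumcenter A B C"
  define \<rho> where "\<rho> = dist Z A"
  have Z: "dist Z A = \<rho>" "dist Z B = \<rho>" "dist Z C = \<rho>"
    using circumcenter_equidistant[OF ABC] by (simp_all add: Z_def \<rho>_def)
  have "\<rho> \<noteq> 0"
    using Z ABC by auto
  obtain P where "?z P = ?z Z
      + (?z A - ?z Z) * (?z B - ?z Z) * (?z C - ?z Z) * cnj d / ((of_real \<rho>)\<^sup>2 * d)"
    by (rule surj_to_complex)
  then have P: "?z P - ?z Z
      = (?z A - ?z Z) * (?z B - ?z Z) * (?z C - ?z Z) * cnj d / ((of_real \<rho>)\<^sup>2 * d)"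
    by simp
  have "dist P Z = \<rho> * \<rho> * \<rho> * cmod d / (\<rho>\<^sup>2 * cmod d)"
    unfolding cmod_to_complex_diff[symmetric] P using Z
    by (simp add: norm_mult norm_divide norm_power cmod_to_complex_diff dist_commute)
  also have "\<dots> = \<rho>"
    using \<open>\<rho> \<noteq> 0\<close> \<open>d \<noteq> 0\<close> by (simp add: power2_eq_square)
  finally have "P \<in> circumcircle A B C"
    by (simp add: circumcircle_def Z_def[symmetric] \<rho>_def dist_commute)
  moreover have "P \<in> affine hull {A, G}"
    using isogonal_point_on_circumcenter_line
      [OF ABC Z E(2) ne(4) F(2) ne(5) assms(6) EF \<open>d \<noteq> 0\<close> P] .
  moreover have "P \<in> affine hull {B, H}"
    by (rule isogonal_point_on_circumcenter_line
        [OF BCA Z(2,3,1) F(2) ne(6) D(2) ne(1) assms(7) FD \<open>d \<noteq> 0\<close>]) (simp add: P mult_ac)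
  moreover have "P \<in> affine hull {C, I}"
    by (rule isogonal_point_on_circumcenter_line
        [OF CAB Z(3,1,2) D(2) ne(2) E(2) ne(3) assms(8) DE \<open>d \<noteq> 0\<close>]) (simp add: P mult_ac)
  ultimately show ?thesis
    using unique_common_point_of_cevians[OF ABC] by blast
qed

end
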